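(* For every integer $k \geq 4$, there is no diregular $(2,k,+3)$-digraph. That is, there is no finite digraph $G$ in which every vertex has in-degree and out-degree exactly $2$, which has exactly $1+2+2^2+\dots+2^k+3$ vertices, and which is $k$-geodetic.
   Context: A digraph $G$ is $k$-geodetic if for every ordered pair of (not necessarily distinct) vertices $x,y$ there is at most one directed path from $x$ to $y$ of length at most $k$; the trivial path of length $0$ from $x$ to $x$ counts, so in particular a $k$-geodetic digraph has no loops, no parallel arcs and no directed cycles of length at most $k$. For integers $d,k$ let $M(d,k)=1+d+d^2+\dots+d^k$ (the Moore bound). A $(d,k,+\epsilon)$-digraph is a $k$-geodetic digraph with minimum out-degree $d$ and order $M(d,k)+\epsilon$; it is diregular if every vertex has in-degree and out-degree exactly $d$. *)

theory Defs
  imports Main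
begin

(* A digraph: finite vertex set V, arc relation E (arc u -> v iff E u v).
   A relation has no parallel arcs automatically. *)

definition out_nbrs :: "'a set \<Rightarrow> ('a \<Rightarrow> 'a \<Rightarrow> bool) \<Rightarrow> 'a \<Rightarrow> 'a set" where
  "out_nbrs V E u = {v \<in> V. E u v}"

definition in_nbrs :: "'a set \<Rightarrow> ('a \<Rightarrow> 'a \<Rightarrow> bool) \<Rightarrow> 'a \<Rightarrow> 'a set" where
  "in_nbrs V E v = {u \<in> V. E u v}"

(* a directed walk given as its vertex sequence; its length is length p - 1 *)
definition is_walk :: "'a set \<Rightarrow> ('a \<Rightarrow> 'a \<Rightarrow> bool) \<Rightarrow> 'a list \<Rightarrow> bool" where
  "is_walk V E p \<longleftrightarrow> p \<noteq> [] \<and> set p \<subseteq> V \<and>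
     (\<forall>i. Suc i < length p \<longrightarrow> E (p ! i) (p ! Suc i))"

(* k-geodetic: for every ordered pair (x,y), not necessarily distinct, at most one
   directed walk from x to y of length at most k (the trivial walk [x] counts). *)
definition k_geodetic :: "'a set \<Rightarrow> ('a \<Rightarrow> 'a \<Rightarrow> bool) \<Rightarrow> nat \<Rightarrow> bool" where
  "k_geodetic V E k \<longleftrightarrow>
     (\<forall>x\<in>V. \<forall>y\<in>V. \<forall>p q. is_walk V E p \<and> is_walk V E q \<and>
        hd p = x \<and> last p = y \<and> hd q = x \<and> last q = y \<and>
        length p \<le> Suc k \<and> length q \<le> Suc k \<longrightarrow> p = q)"

definition diregular :: "'a set \<Rightarrow> ('a \<Rightarrow> 'a \<Rightarrow> bool) \<Rightarrow> nat \<Rightarrow> bool" where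
  "diregular V E d \<longleftrightarrow>
     (\<forall>v\<in>V. card (out_nbrs V E v) = d \<and> card (in_nbrs V E v) = d)"

definition moore_bound :: "nat \<Rightarrow> nat \<Rightarrow> nat" where
  "moore_bound d k = (\<Sum>i\<le>k. d ^ i)"

end

theory Submission
  imports Defs
begin

text \<open>
  Every vertex \<open>x\<close> reaches all vertices but a set \<open>O(x)\<close> of three outliers by a unique walk of
  length at most \<open>k\<close>. Suppose \<open>u\<close> and \<open>v\<close> have exactly one common out-neighbour \<open>z\<close>, say
  \<open>N(u) = {a, z}\<close> and \<open>N(v) = {b, z}\<close>. Removing the tree of depth \<open>k - 1\<close> below \<open>z\<close> shows that the
  trees of depth \<open>k - 1\<close> below \<open>a\<close> and \<open>b\<close> span almost the same set, and a vertex lying at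
  different depths in both must be close to the leaves of one of them. It follows that \<open>b\<close> belongs
  to \<open>O(u)\<close> and that \<open>a\<close> and \<open>b\<close> have a common out-neighbour. The second in-neighbour \<open>u'\<close> of \<open>a\<close>
  forms such a pair with \<open>u\<close> as well; writing \<open>N(u') = {a, z'}\<close>, both \<open>b\<close> and \<open>z'\<close> lie in \<open>O(u)\<close>,
  neither is a near descendant of the other, and this contradicts \<open>|O(u)| = 3\<close>.

  Hence vertices with a common out-neighbour have the same out-neighbourhood, so the digraph is a
  line digraph of a diregular \<open>(k - 1)\<close>-geodetic digraph of excess 2. The same argument applies to
  that digraph, so it too would be a line digraph, but its order \<open>2\<^sup>k + 1\<close> is odd.
\<close>

section \<open>Vertices at a given walk distance\<close>

fun level :: "('a \<Rightarrow> 'a set) \<Rightarrow> nat \<Rightarrow> 'a \<Rightarrow> 'a set" where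
  "level N 0 x = {x}"
| "level N (Suc i) x = (\<Union>y\<in>N x. level N i y)"

lemma level_add: "level N (i + j) x = (\<Union>y\<in>level N i x. level N j y)"
  by (induction i arbitrary: x) auto

lemma level_addI: "y \<in> level N i x \<Longrightarrow> w \<in> level N j y \<Longrightarrow> w \<in> level N (i + j) x"
  by (auto simp: level_add)

lemma level_SucI: "y \<in> level N i x \<Longrightarrow> w \<in> N y \<Longrightarrow> w \<in> level N (Suc i) x"
  using level_addI[of y N i x w 1] by simp

lemma level_consI: "y \<in> N x \<Longrightarrow> w \<in> level N i y \<Longrightarrow> w \<in> level N (Suc i) x"
  by auto

lemma level_SucD: "w \<in> level N (Suc i) x \<Longrightarrow> \<exists>y\<in>level N i x. w \<in> N y"
  using level_add[of N i 1 x] by auto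

lemma card_2_other:
  assumes "card A = 2" "c \<in> A"
  obtains d where "A = {c, d}" "c \<noteq> d"
  using assms by (auto simp: card_2_iff)

section \<open>Digraphs of excess 2 or 3 and their outliers\<close>

text \<open>Geodecity is phrased through levels: \<open>level_unique\<close> excludes two walks of
  different lengths, \<open>branch_disjoint\<close> two walks that part and meet again. The
  parameter \<open>e\<close> serves two digraphs: the given one with \<open>e = 3\<close>, and its
  root as a line digraph, where \<open>e = 2\<close> and \<open>k\<close> drops by one. In
  \<open>order\<close> the \<open>+ 1\<close> avoids subtraction.\<close>

locale excess_digraph =
  fixes V :: "'a set" and N :: "'a \<Rightarrow> 'a set" and k e :: nat
  assumes fin: "finite V"
    and nbr_sub: "x \<in> V \<Longrightarrow> N x \<subseteq> V"
    and outdeg: "x \<in> V \<Longrightarrow> card (N x) = 2"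
    and indeg: "y \<in> V \<Longrightarrow> card {x \<in> V. y \<in> N x} = 2"
    and level_unique: "x \<in> V \<Longrightarrow> y \<in> level N i x \<Longrightarrow> y \<in> level N j x \<Longrightarrow> i \<le> k \<Longrightarrow> j \<le> k \<Longrightarrow> i = j"
    and branch_disjoint: "x \<in> V \<Longrightarrow> c \<in> N x \<Longrightarrow> d \<in> N x \<Longrightarrow> c \<noteq> d \<Longrightarrow> i < k \<Longrightarrow> j < k \<Longrightarrow>
      level N i c \<inter> level N j d = {}"
    and order: "card V + 1 = 2 ^ Suc k + e"
    and excess: "e = 2 \<or> e = 3"
    and large: "e < k"
begin

abbreviation "L \<equiv> level N"

definition outliers :: "'a \<Rightarrow> 'a set" where
  "outliers x = V - (\<Union>i\<le>k. L i x)"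

lemma level_sub: "x \<in> V \<Longrightarrow> L i x \<subseteq> V"
proof (induction i arbitrary: x)
  case (Suc i)
  then show ?case using nbr_sub by fastforce
qed simp

lemma level_in_V: "x \<in> V \<Longrightarrow> y \<in> L i x \<Longrightarrow> y \<in> V"
  using level_sub by blast

lemma nbr_in_V: "x \<in> V \<Longrightarrow> y \<in> N x \<Longrightarrow> y \<in> V"
  using nbr_sub by blast

lemma finite_level: "x \<in> V \<Longrightarrow> finite (L i x)"
  using level_sub fin finite_subset by blast

lemma no_cycle: "x \<in> V \<Longrightarrow> x \<in> L i x \<Longrightarrow> i \<le> k \<Longrightarrow> i = 0"
  using level_unique[of x x i 0] by simp

lemma branch_unique:
  assumes "x \<in> V" "c \<in> N x" "d \<in> N x" "w \<in> L i c" "w \<in> L j d" "i < k" "j < k"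
  shows "c = d"
  using branch_disjoint[of x c d i j] assms by blast

text \<open>Walks to two different vertices at depth \<open>p\<close> part at some vertex, and there
  \<open>branch_unique\<close> applies to what remains of them.\<close>

lemma ancestor_unique:
  assumes "x \<in> V" "y \<in> L p x" "y' \<in> L p x" "w \<in> L i y" "w \<in> L j y'" "p + i \<le> k" "p + j \<le> k"
  shows "y = y'"
  using assms
proof (induction p arbitrary: x)
  case (Suc p)
  then obtain c d where cd: "c \<in> N x" "d \<in> N x" "y \<in> L p c" "y' \<in> L p d" by auto
  have "c = d"
    using branch_unique[OF Suc.prems(1) cd(1,2) level_addI[OF cd(3) Suc.prems(4)]
        level_addI[OF cd(4) Suc.prems(5)]] Suc.prems by simp
  then show ?case
    using Suc.IH[OF nbr_in_V[OF Suc.prems(1) cd(1)] cd(3) _ Suc.prems(4,5)] cd Suc.prems by simp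
qed simp

lemma nbr_elems: "x \<in> V \<Longrightarrow> \<exists>c d. N x = {c, d} \<and> c \<noteq> d"
  by (metis card_2_iff outdeg)

lemma card_level: "x \<in> V \<Longrightarrow> i \<le> k \<Longrightarrow> card (L i x) = 2 ^ i"
proof (induction i arbitrary: x)
  case (Suc i)
  obtain c d where cd: "N x = {c, d}" "c \<noteq> d" using nbr_elems Suc by blast
  have V: "c \<in> V" "d \<in> V" using cd nbr_in_V Suc by auto
  have "L i c \<inter> L i d = {}" using branch_disjoint[of x c d i i] cd Suc by simp
  then show ?case using cd V Suc by (simp add: card_Un_disjoint finite_level)
qed simp

text \<open>The levels up to \<open>k\<close> are disjoint of sizes \<open>2 ^ i\<close>, so they
  miss exactly \<open>e\<close> vertices.\<close>

lemma card_outliers: "x \<in> V \<Longrightarrow> card (outliers x) = e"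
proof -
  assume x: "x \<in> V"
  have "card (\<Union>i\<le>k. L i x) = (\<Sum>i\<le>k. card (L i x))"
    using level_unique[OF x] by (intro card_UN_disjoint) (auto simp: finite_level[OF x])
  also have "\<dots> = (\<Sum>i\<le>k. 2 ^ i)" using card_level[OF x] by simp
  also have "\<dots> + 1 = 2 ^ Suc k" by (induction k) auto
  finally have "card (\<Union>i\<le>k. L i x) + 1 = 2 ^ Suc k" by simp
  moreover have "(\<Union>i\<le>k. L i x) \<subseteq> V" using level_sub[OF x] by blast
  ultimately show ?thesis unfolding outliers_def using order fin
    by (simp add: card_Diff_subset finite_subset)
qed

lemma outliers_sub: "outliers x \<subseteq> V"
  by (auto simp: outliers_def)

lemma finite_outliers: "finite (outliers x)"
  using fin finite_subset outliers_sub by blast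

lemma outlier_not_level: "w \<in> outliers x \<Longrightarrow> w \<in> L i x \<Longrightarrow> k < i"
  by (force simp: outliers_def not_le)

lemma outlier_not_below: "w \<in> outliers x \<Longrightarrow> c \<in> N x \<Longrightarrow> w \<in> L i c \<Longrightarrow> k \<le> i"
  using outlier_not_level[of w x "Suc i"] by (auto simp: less_Suc_eq_le)

section \<open>Pairs of vertices with exactly one common out-neighbour\<close>

definition fork :: "'a \<Rightarrow> 'a \<Rightarrow> 'a \<Rightarrow> 'a \<Rightarrow> 'a \<Rightarrow> bool" where
  "fork u v z a b \<longleftrightarrow> u \<in> V \<and> v \<in> V \<and> N u = {a, z} \<and> N v = {b, z} \<and> a \<noteq> b \<and> a \<noteq> z \<and> b \<noteq> z"

lemma fork_sym: "fork u v z a b \<Longrightarrow> fork v u z b a"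
  by (auto simp: fork_def)

lemma forkD:
  assumes "fork u v z a b"
  shows "u \<in> V" "v \<in> V" "a \<in> V" "b \<in> V" "z \<in> V" "N u = {a, z}" "N v = {b, z}"
    "a \<noteq> b" "a \<noteq> z" "b \<noteq> z" "u \<noteq> v"
  using assms nbr_in_V unfolding fork_def by (auto simp: doubleton_eq_iff)

text \<open>Otherwise \<open>v\<close> would reach \<open>z\<close> both directly and through \<open>b\<close> and \<open>u\<close>.\<close>

lemma fork_tip:
  assumes "fork u v z a b" "u \<in> L i b" "i < k"
  shows "Suc i = k"
proof (rule ccontr)
  note f = forkD[OF assms(1)]
  assume "Suc i \<noteq> k"
  moreover have "z \<in> L (Suc i) b" using level_SucI[OF assms(2)] f by simp
  ultimately show False using branch_unique[OF f(2), of b z z "Suc i" 0] f assms(3) by simp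
qed

text \<open>If \<open>u\<close> reached \<open>w\<close> through \<open>z\<close>, then
  \<open>v\<close> would reach \<open>w\<close> both through \<open>z\<close> and through
  \<open>b\<close>.\<close>

lemma fork_cover:
  assumes "fork u v z a b" "w \<in> L i b" "i < k"
  shows "w = u \<or> w \<in> outliers u \<or> (\<exists>m<k. w \<in> L m a)"
proof (rule ccontr)
  note f = forkD[OF assms(1)]
  assume c: "\<not> ?thesis"
  have "w \<in> V" using level_in_V f assms by blast
  with c obtain j where j: "j \<le> k" "w \<in> L j u" by (auto simp: outliers_def)
  with c obtain m where m: "j = Suc m" by (cases j) auto
  with j f c have "w \<in> L m z" by auto
  then show False using branch_unique[OF f(2), of b z w i m] assms f m j by simp
qed

text \<open>A walk from \<open>u\<close> to \<open>v\<close> through \<open>z\<close> would close a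
  cycle with the arc from \<open>v\<close> to \<open>z\<close>. For a walk through \<open>a\<close>,
  the mirrored \<open>fork_tip\<close> fixes the length.\<close>

lemma fork_v_cases:
  assumes "fork u v z a b"
  shows "v \<in> outliers u \<or> v \<in> L (k - 1) a"
proof (rule ccontr)
  note f = forkD[OF assms(1)]
  assume c: "\<not> ?thesis"
  with f obtain j where j: "j \<le> k" "v \<in> L j u" by (auto simp: outliers_def)
  with f obtain m where m: "j = Suc m" by (cases j) auto
  consider "v \<in> L m a" | "v \<in> L m z" using j m f by auto
  then show False
  proof cases
    case 1
    with fork_tip[OF fork_sym[OF assms] this] j m c show False by auto
  next
    case 2
    have "z \<in> L (Suc m) z" using level_SucI[OF 2] f by simp
    with no_cycle[OF f(5) this] m j show False by simp
  qed
qed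

text \<open>The \<open>2 ^ (k - m)\<close> descendants of \<open>w\<close> at distance
  \<open>k - m\<close> all fall into \<open>u\<close> and its outliers. That set has at most four
  elements, so \<open>m\<close> is \<open>k - 1\<close> or \<open>k - 2\<close>, and in the latter
  case the set is filled exactly.\<close>

lemma fork_descend:
  assumes "fork u v z a b" "w \<in> L l b" "w \<in> L m a" "l < m" "m < k"
  shows "(Suc m = k \<and> N w \<subseteq> insert u (outliers u) \<and> (u \<in> N w \<longrightarrow> l + 2 = k)) \<or>
    (e = 3 \<and> m + 2 = k \<and> l + 3 = k \<and> L 2 w = insert u (outliers u))"
proof -
  note f = forkD[OF assms(1)]
  have w: "w \<in> V" using level_in_V f assms by blast
  \<comment> \<open>These vertices are \<open>k\<close> steps below \<open>a\<close>, hence outside its tree, but still in the tree below \<open>b\<close>.\<close>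
  have sub: "L (k - m) w \<subseteq> insert u (outliers u)"
  proof
    fix y assume y: "y \<in> L (k - m) w"
    have yb: "y \<in> L (l + (k - m)) b" and ya: "y \<in> L k a"
      using level_addI[OF assms(2) y] level_addI[OF assms(3) y] assms by auto
    have "j = k" if "y \<in> L j a" "j < k" for j
      using level_unique[OF f(3) that(1) ya] that by simp
    then show "y \<in> insert u (outliers u)"
      using fork_cover[OF assms(1) yb] assms by fastforce
  qed
  have cardI: "card (insert u (outliers u)) = Suc e"
    using card_outliers[OF f(1)] finite_outliers outlier_not_level[of u u 0]
    by (subst card_insert_disjoint) auto
  have "card (L (k - m) w) \<le> Suc e"
    using card_mono[OF _ sub] finite_outliers cardI by simp
  then have le: "2 ^ (k - m) \<le> Suc e" using card_level[OF w, of "k - m"] by simp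
  have tip: "l + Suc i = k" if "u \<in> L i w" "l + i < k" for i
    using fork_tip[OF assms(1) level_addI[OF assms(2) that(1)]] that by simp
  have "\<not> 3 \<le> k - m"
  proof
    assume "3 \<le> k - m"
    then have "2 ^ 3 \<le> (2::nat) ^ (k - m)" by (intro power_increasing) auto
    with le excess show False by auto
  qed
  then consider "Suc m = k" | "m + 2 = k" using assms by linarith
  then show ?thesis
  proof cases
    case 1
    then have "k - m = Suc 0" by simp
    with sub tip[of "Suc 0"] assms 1 show ?thesis by simp
  next
    case 2
    then have km: "k - m = 2" by simp
    with le excess have e3: "e = 3" by auto
    have "L 2 w = insert u (outliers u)"
      using sub cardI card_level[OF w, of 2] km e3 2 finite_outliers
      by (intro card_subset_eq) auto
    with tip[of 2] e3 2 assms show ?thesis by auto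
  qed
qed

text \<open>This combines \<open>fork_cover\<close> with \<open>fork_descend\<close>, applied to the
  fork itself if \<open>w\<close> lies deeper below \<open>a\<close> than below \<open>b\<close>
  (\<open>down\<close>, \<open>down2\<close>), and to its mirror image in the opposite case
  (\<open>up\<close>, \<open>up2\<close>). It is used with \<open>l \<le> 3\<close>, where comparing
  \<open>l\<close> with \<open>k\<close> removes several cases.\<close>

lemma fork_cases:
  assumes "fork u v z a b" "w \<in> L l b" "l < k"
  obtains (tip) "w = u" "Suc l = k"
  | (out) "w \<in> outliers u"
  | (same) "w \<in> L l a"
  | (down) "Suc l < k" "w \<in> L (k - 1) a" "N w \<subseteq> insert u (outliers u)" "u \<in> N w \<Longrightarrow> l + 2 = k"
  | (down2) "e = 3" "l + 3 = k" "w \<in> L (k - 2) a" "L 2 w = insert u (outliers u)"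
  | (up) m where "Suc l = k" "m < l" "w \<in> L m a"
  | (up2) "e = 3" "l + 2 = k" "w \<in> L (k - 3) a" "L 2 w = insert v (outliers v)"
proof -
  consider "w = u" | "w \<in> outliers u" | m where "m < k" "w \<in> L m a"
    using fork_cover[OF assms] by blast
  then show ?thesis
  proof cases
    case 1
    then show ?thesis using tip fork_tip[OF assms(1)] assms by blast
  next
    case 2
    then show ?thesis using out by blast
  next
    case (3 m)
    consider "l = m" | "l < m" | "m < l" by linarith
    then show ?thesis
    proof cases
      case 1
      then show ?thesis using same 3 by blast
    next
      case 2
      from fork_descend[OF assms(1,2) 3(2) 2 3(1)] show ?thesis
      proof (elim disjE conjE)
        assume h: "Suc m = k" "N w \<subseteq> insert u (outliers u)" "u \<in> N w \<longrightarrow> l + 2 = k"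
        then have "m = k - 1" by simp
        with down h 2 3 show ?thesis by auto
      next
        assume h: "e = 3" "m + 2 = k" "l + 3 = k" "L 2 w = insert u (outliers u)"
        then have "m = k - 2" by simp
        with down2 h 2 3 show ?thesis by auto
      qed
    next
      case lt: 3
      from fork_descend[OF fork_sym[OF assms(1)] 3(2) assms(2) lt assms(3)] show ?thesis
      proof (elim disjE conjE)
        assume "Suc l = k"
        with up lt 3 show ?thesis by auto
      next
        assume h: "e = 3" "l + 2 = k" "m + 3 = k" "L 2 w = insert v (outliers v)"
        then have "m = k - 3" by simp
        with up2 h 3 show ?thesis by auto
      qed
    qed
  qed
qed

section \<open>The vertex \<open>b\<close> of a fork is an outlier of \<open>u\<close>\<close>

lemma ex_nbr_neq: "x \<in> V \<Longrightarrow> \<exists>y\<in>N x. y \<noteq> u"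
  using nbr_elems[of x] by auto

lemma nbr_other: "x \<in> V \<Longrightarrow> c \<in> N x \<Longrightarrow> \<exists>d. N x = {c, d} \<and> c \<noteq> d"
  using nbr_elems[of x] by auto

lemma nbr_subset_eq: "x \<in> V \<Longrightarrow> y \<in> V \<Longrightarrow> N x \<subseteq> N y \<Longrightarrow> N x = N y"
  using outdeg[of x] outdeg[of y] card_subset_eq[of "N y" "N x"] finite_level[of y 1] by simp

lemma nbr_two: "x \<in> V \<Longrightarrow> c \<in> N x \<Longrightarrow> d \<in> N x \<Longrightarrow> c \<noteq> d \<Longrightarrow> N x = {c, d}"
  using nbr_elems[of x] by auto

lemma level_2: "L 2 x = (\<Union>y\<in>N x. N y)"
  by (simp add: numeral_2_eq_2)

lemma level_2I: "y \<in> N x \<Longrightarrow> w \<in> N y \<Longrightarrow> w \<in> L 2 x"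
  by (auto simp: level_2)

lemma level_3I: "y \<in> L 2 x \<Longrightarrow> w \<in> N y \<Longrightarrow> w \<in> L 3 x"
  using level_SucI[of y N 2 x w] by simp

lemma level_3D: "w \<in> L 3 x \<Longrightarrow> \<exists>y\<in>L 2 x. w \<in> N y"
  using level_SucD[of w N 2 x] by simp

lemma level_4I: "y \<in> L 3 x \<Longrightarrow> w \<in> N y \<Longrightarrow> w \<in> L 4 x"
  using level_SucI[of y N 3 x w] by simp

text \<open>Apply \<open>fork_cases\<close> to \<open>b\<close> itself, at depth \<open>0\<close>:
  apart from \<open>out\<close> only \<open>down\<close> survives, and there \<open>u\<close> cannot
  be in \<open>N b\<close>.\<close>

lemma fork_not_outlier:
  assumes "fork u v z a b" "b \<notin> outliers u"
  shows "b \<in> L (k - 1) a" "N b \<subseteq> outliers u"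
proof -
  note f = forkD[OF assms(1)]
  have k: "3 \<le> k" using large excess by auto
  have "b \<in> L 0 b" "0 < k" using k by auto
  from assms(1) this have "b \<in> L (k - 1) a \<and> N b \<subseteq> outliers u"
    by (cases rule: fork_cases) (use assms f k excess large in auto)
  then show "b \<in> L (k - 1) a" "N b \<subseteq> outliers u" by auto
qed

text \<open>If not, counting gives \<open>N b = outliers u\<close>. For \<open>k \<ge> 4\<close> the
  second levels of \<open>a\<close> and \<open>b\<close> then agree, so \<open>b\<close>, which lies
  \<open>k - 1\<close> steps below \<open>a\<close>, is on a short cycle. For \<open>k = 3\<close>
  too few candidates remain for the second level of \<open>b\<close>.\<close>

lemma fork_outlier_excess_2:
  assumes F: "fork u v z a b" and e: "e = 2"
  shows "b \<in> outliers u"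
proof (rule ccontr)
  note f = forkD[OF F]
  assume nb: "b \<notin> outliers u"
  have k: "3 \<le> k" using large e by auto
  note bA = fork_not_outlier(1)[OF F nb]
  have Nb: "N b = outliers u"
    using fork_not_outlier(2)[OF F nb] card_outliers[OF f(1)] outdeg[OF f(4)] e finite_outliers
    by (intro card_subset_eq) auto
  have uniq: "i = j" if "y \<in> L i b" "y \<in> L j b" "i \<le> k" "j \<le> k" for i j y
    using level_unique[OF f(4)] that by blast
  have Nb1: "y \<in> L 1 b" if "y \<in> outliers u" for y using that Nb by simp
  show False
  proof (cases "k = 3")
    case False
    then have k4: "4 \<le> k" using k by simp
    have "L 2 b \<subseteq> L 2 a"
    proof
      fix w assume w: "w \<in> L 2 b"
      have wV: "w \<in> V" using level_in_V f w by blast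
      have "2 < k" using k4 by simp
      with F w show "w \<in> L 2 a"
      proof (cases rule: fork_cases)
        case out
        then show ?thesis using uniq[OF w Nb1] k4 by simp
      next
        case down
        obtain y where "y \<in> N w" "y \<noteq> u" using ex_nbr_neq wV by blast
        then show ?thesis using uniq[OF level_3I[OF w] Nb1] down k4 by fastforce
      qed (use k4 e in auto)
    qed
    then have "L 2 b = L 2 a"
      using card_level[OF f(3), of 2] card_level[OF f(4), of 2] k finite_level[OF f(3)]
      by (intro card_subset_eq) auto
    then have "L (2 + (k - 3)) b = L (2 + (k - 3)) a" by (simp only: level_add)
    moreover have "2 + (k - 3) = k - 1" using k by simp
    ultimately have "b \<in> L (k - 1) b" using bA by (simp only:)
    then show False using no_cycle[OF f(4)] k by fastforce
  next
    case k3: True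
    have nb3: "b \<notin> L 3 b" "b \<notin> L 2 b" using no_cycle[OF f(4)] k3 by force+
    have vb: "b \<in> N v" using f by simp
    have nvb: "v \<notin> L 2 b" using nb3 level_3I vb by blast
    have "v \<notin> outliers u" using Nb nb3 level_2I vb by blast
    then have "v \<in> L 2 a" using fork_v_cases[OF F] k3 by simp
    then obtain a2 where a2: "a2 \<in> N a" "v \<in> N a2" by (auto simp: level_2)
    obtain a1 where a1: "a1 \<in> N a" "b \<in> N a1" using bA k3 by (auto simp: level_2)
    have V: "a1 \<in> V" "a2 \<in> V" using a1 a2 f nbr_in_V by blast+
    have "a1 \<noteq> a2"
    proof
      assume "a1 = a2"
      then have "b \<in> L 2 a1" using level_2I a2 vb by blast
      then show False using level_unique[OF V(1), of b 2 1] a1 k3 by simp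
    qed
    then have Na: "N a = {a1, a2}" using nbr_two f a1 a2 by blast
    obtain s where s: "N a1 = {b, s}" using nbr_other[OF V(1)] a1 by blast
    obtain t where t: "N a2 = {v, t}" using nbr_other[OF V(2)] a2 by blast
    have cover: "w \<in> {u, a, a2, s, t}" if w: "w \<in> L 2 b" for w
    proof -
      have "w \<notin> outliers u" using uniq[OF w Nb1] k3 by auto
      then consider "w = u" | m where "m < 3" "w \<in> L m a" using fork_cover[OF F w] k3 by auto
      then show ?thesis
      proof cases
        case (2 m)
        then have "m = 0 \<or> m = 1 \<or> m = 2" by auto
        then have "w \<in> {a, a1, a2, b, s, v, t}" using 2 Na s t by (auto simp: level_2)
        moreover have "w \<noteq> a1" using nb3 level_3I[OF w] a1 by blast
        ultimately show ?thesis using w nb3 nvb by auto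
      qed simp
    qed
    \<comment> \<open>No arc runs inside \<open>L 2 b\<close>. This leaves at most three of the five
      candidates, while \<open>L 2 b\<close> has four elements.\<close>
    have step: "y \<notin> L 2 b" if "w \<in> L 2 b" "y \<in> N w" for w y
      using uniq[of y 2 3] level_3I[OF that] k3 by auto
    have "\<exists>p q r. L 2 b \<subseteq> {p, q, r}"
    proof (cases "a2 \<in> L 2 b")
      case True
      then have "t \<notin> L 2 b" "a \<notin> L 2 b" using step[of a2 t] step[of a a2] t Na by auto
      then have "L 2 b \<subseteq> {u, a2, s}" using cover by blast
      then show ?thesis by blast
    next
      case False
      have "u \<notin> L 2 b \<or> a \<notin> L 2 b" using step[of u a] f by auto
      then have "L 2 b \<subseteq> {u, s, t} \<or> L 2 b \<subseteq> {a, s, t}" using cover False by blast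
      then show ?thesis by blast
    qed
    then obtain p q r where "L 2 b \<subseteq> {p, q, r}" by blast
    then have "card (L 2 b) \<le> card {p, q, r}" by (intro card_mono) auto
    also have "\<dots> \<le> 3" by (simp add: card_insert_if)
    finally show False using card_level[OF f(4), of 2] k by simp
  qed
qed

text \<open>If not, \<open>outliers u\<close> consists of \<open>N b\<close> and one more vertex
  \<open>x\<close>. The second level of \<open>b\<close> is that of \<open>a\<close> with the
  ancestor \<open>s\<close> of \<open>b\<close> replaced by \<open>x\<close>. For
  \<open>k > 4\<close> this forces \<open>N x = N s\<close>, so \<open>x\<close> leads to
  \<open>b\<close> as \<open>s\<close> does, which closes a cycle of length \<open>k - 1\<close>.
  For \<open>k = 4\<close> one common out-neighbour of \<open>x\<close> and \<open>s\<close>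
  suffices.\<close>

lemma fork_outlier_excess_3:
  assumes F: "fork u v z a b" and e: "e = 3"
  shows "b \<in> outliers u"
proof (rule ccontr)
  note f = forkD[OF F]
  assume nb: "b \<notin> outliers u"
  have k: "4 \<le> k" using large e by auto
  note bA = fork_not_outlier(1)[OF F nb] and Nbs = fork_not_outlier(2)[OF F nb]
  have "card (outliers u - N b) = 1"
    using card_Diff_subset[of "N b" "outliers u"] Nbs card_outliers[OF f(1)] outdeg[OF f(4)] e
      finite_outliers finite_subset by fastforce
  then obtain x where "outliers u - N b = {x}" by (auto simp: card_1_singleton_iff)
  then have Ou: "outliers u = insert x (N b)" and xNb: "x \<notin> N b" using Nbs by auto
  have xV: "x \<in> V" using Ou outliers_sub by blast
  have uniq: "i = j" if "y \<in> L i b" "y \<in> L j b" "i \<le> k" "j \<le> k" for i j y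
    using level_unique[OF f(4)] that by blast
  have cyc: "b \<notin> L i b" if "0 < i" "i \<le> k" for i using no_cycle[OF f(4)] that by blast
  have notNb: "y \<notin> N b" if "y \<in> L i b" "2 \<le> i" "i \<le> k" for y i
    using uniq[of y i 1] that k by fastforce
  have vb: "b \<in> N v" using f by simp
  have k13: "2 + (k - 3) = k - 1" using k by simp
  then have "b \<in> L (2 + (k - 3)) a" using bA by simp
  \<comment> \<open>\<open>s\<close> is the vertex two steps below \<open>a\<close> on the way to
    \<open>b\<close>.\<close>
  then obtain s where s: "s \<in> L 2 a" "b \<in> L (k - 3) s" unfolding level_add by blast
  have sV: "s \<in> V" using level_in_V f s by blast
  have scyc: "s \<notin> L i b" if "i \<le> 3" for i
    using level_addI[OF _ s(2), of i b] cyc[of "i + (k - 3)"] that k by auto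
  have xa: "x \<notin> L i a" if "i < k" for i
    using outlier_not_below[of x u a i] that f Ou by auto
  \<comment> \<open>The exceptions with \<open>k = 4\<close> come from the cases \<open>down\<close>
    and \<open>up2\<close>.\<close>
  have L2: "w = x \<or> w \<in> L 2 a \<or> (k = 4 \<and> w \<in> L 3 a \<and> N w = {u, x}) \<or> (k = 4 \<and> w \<in> N a)"
    if w: "w \<in> L 2 b" for w
  proof -
    have wV: "w \<in> V" using level_in_V f w by blast
    have "2 < k" using k by simp
    with F w show ?thesis
    proof (cases rule: fork_cases)
      case out
      then show ?thesis using notNb[OF w] Ou k by auto
    next
      case down
      have "N w \<inter> N b = {}" using notNb[OF level_3I[OF w]] k by auto
      then have "N w \<subseteq> {u, x}" using down Ou by auto
      moreover obtain c d where "N w = {c, d}" "c \<noteq> d" using nbr_elems wV by blast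
      ultimately have "N w = {u, x}" by auto
      then show ?thesis using down by auto
    next
      case down2
      obtain c where c: "c \<in> N b" using ex_nbr_neq f by blast
      then have "c \<in> L 2 w" using down2 Ou by simp
      then have "c \<in> L (2 + 2) b" using level_addI[OF w] by blast
      then show ?thesis using notNb[of c 4] c k by simp
    next
      case up2
      then show ?thesis by auto
    qed (use k in auto)
  qed
  have "x \<in> L 2 b \<and> L 2 a - {s} \<subseteq> L 2 b"
  proof (cases "k = 4")
    case False
    have sub: "L 2 b \<subseteq> insert x (L 2 a - {s})" using L2 False scyc[of 2] by auto
    have "card (insert x (L 2 a - {s})) \<le> Suc (card (L 2 a - {s}))"
      by (simp add: card_insert_if finite_level f)
    then have "card (insert x (L 2 a - {s})) \<le> card (L 2 b)"
      using card_level[OF f(4), of 2] card_level[OF f(3), of 2] s(1) k by simp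
    then have "L 2 b = insert x (L 2 a - {s})"
      using sub by (intro card_seteq) (auto simp: finite_level f)
    then show ?thesis by auto
  next
    case k4: True
    obtain a1 where a1: "a1 \<in> N a" "s \<in> N a1" using s by (auto simp: level_2)
    obtain a2 where a2: "N a = {a1, a2}" using nbr_other[OF f(3)] a1 by blast
    have V: "a1 \<in> V" "a2 \<in> V" using a2 f nbr_in_V by blast+
    obtain r where r: "N a1 = {s, r}" using nbr_other[OF V(1)] a1 by blast
    obtain p q where pq: "N a2 = {p, q}" using nbr_elems[OF V(2)] by blast
    have L2a: "L 2 a = {s, r, p, q}" using a2 r pq by (auto simp: level_2)
    have step: "y \<notin> L 2 b" if "w \<in> L 2 b" "y \<in> N w" for w y
      using uniq[of y 2 3] level_3I[OF that] k4 by auto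
    have na1: "a1 \<notin> L 2 b" using scyc[of 3] level_3I a1 by auto
    \<comment> \<open>At most one vertex of \<open>L 2 b\<close> has out-neighbourhood
      \<open>{u, x}\<close>. If there is one, it is \<open>g\<close>, and its arc to
      \<open>x\<close> keeps \<open>x\<close> off the level; otherwise \<open>g\<close> is
      \<open>x\<close>.\<close>
    obtain g where g: "g = x \<or> (g \<in> L 3 a \<and> N g = {u, x})" "L 2 b \<subseteq> {r, p, q, a2, g}"
    proof (cases "\<exists>g\<in>L 2 b. g \<in> L 3 a \<and> N g = {u, x}")
      case True
      then obtain g where g: "g \<in> L 2 b" "g \<in> L 3 a" "N g = {u, x}" by blast
      have "w = g" if "w \<in> L 2 b" "N w = {u, x}" for w
        using ancestor_unique[OF f(4) that(1) g(1), of u 1 1] that g k by simp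
      moreover have "x \<notin> L 2 b" using step g by blast
      ultimately have "L 2 b \<subseteq> {r, p, q, a2, g}" using L2 L2a a2 na1 scyc[of 2] by auto
      then show ?thesis using that g by blast
    next
      case False
      then have "L 2 b \<subseteq> {r, p, q, a2, x}" using L2 L2a a2 na1 scyc[of 2] by auto
      then show ?thesis using that by blast
    qed
    have c4: "card (L 2 b) = 4" using card_level[OF f(4), of 2] k by simp
    \<comment> \<open>If \<open>a2\<close> were on the level, its out-neighbours \<open>p\<close>
      and \<open>q\<close> would not be, leaving three candidates.\<close>
    have na2: "a2 \<notin> L 2 b"
    proof
      assume "a2 \<in> L 2 b"
      then have "L 2 b \<subseteq> {r, a2, g}" using step[of a2] pq g by auto
      then have "card (L 2 b) \<le> card {r, a2, g}" by (intro card_mono) auto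
      also have "\<dots> \<le> 3" by (simp add: card_insert_if)
      finally show False using c4 by simp
    qed
    have "L 2 b \<subseteq> {r, p, q, g}" using g na2 by blast
    moreover have "card {r, p, q, g} \<le> card (L 2 b)" unfolding c4 by (simp add: card_insert_if)
    ultimately have L2b: "L 2 b = {r, p, q, g}" by (intro card_seteq) auto
    \<comment> \<open>Otherwise the parent of \<open>g\<close> on \<open>L 2 a\<close> must be
      \<open>s\<close>, which would reach \<open>g\<close> directly and also through
      \<open>b\<close> in three steps.\<close>
    have "g = x"
    proof (rule ccontr)
      assume "g \<noteq> x"
      then have "g \<in> L 3 a" using g by blast
      then obtain y where y: "y \<in> L 2 a" "g \<in> N y" using level_3D by blast
      have "y \<notin> L 2 b" using step[of y g] y L2b by auto
      then have "y = s" using y L2a L2b by auto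
      moreover have "g \<in> L (1 + 2) s" using level_addI[of b N 1 s g 2] s L2b k4 by simp
      ultimately show False using level_unique[OF sV, of g 1 "1 + 2"] y k by simp
    qed
    then show ?thesis using L2b L2a by auto
  qed
  then have x2: "x \<in> L 2 b" and rest: "\<And>y. y \<in> L 2 a \<Longrightarrow> y \<noteq> s \<Longrightarrow> y \<in> L 2 b" by auto
  have notO: "y \<notin> outliers u" if "y \<in> L i b" "3 \<le> i" "i \<le> k" for y i
    using notNb[OF that(1)] that uniq[OF x2, of i] Ou by auto
  \<comment> \<open>In the case \<open>same\<close>, the parent of \<open>w\<close> on
    \<open>L 2 a\<close> cannot lie on \<open>L 2 b\<close>, where \<open>x\<close> is the only
    parent of \<open>w\<close>. Hence it is \<open>s\<close>.\<close>
  have Nx: "w \<in> N s \<or> (k = 4 \<and> (w = u \<or> w = a))" if wx: "w \<in> N x" for w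
  proof -
    have w: "w \<in> L 3 b" using level_3I[OF x2 wx] .
    have wV: "w \<in> V" using level_in_V f w by blast
    have n2: "w \<notin> L 2 a"
      using rest[of w] uniq[OF w, of 2] scyc[of 3] w k by auto
    have "3 < k" using k by simp
    with F w show ?thesis
    proof (cases rule: fork_cases)
      case tip
      then show ?thesis by simp
    next
      case out
      then show ?thesis using notO[OF w] k by simp
    next
      case same
      then obtain y where y: "y \<in> L 2 a" "w \<in> N y" using level_3D by blast
      have "y \<notin> L 2 b"
        using ancestor_unique[OF f(4) _ x2, of y w 1 1] y wx k xa[of 2] by auto
      then show ?thesis using rest y by blast
    next
      case down
      obtain y where "y \<in> N w" "y \<noteq> u" using ex_nbr_neq wV by blast
      then show ?thesis using notO[OF level_4I[OF w]] down k by fastforce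
    next
      case down2
      have "x \<in> L 2 w" using down2 Ou by simp
      then have "x \<in> L (3 + 2) b" using level_addI[OF w] by blast
      then show ?thesis using notO[of x 5] Ou down2 by simp
    next
      case (up m)
      consider "m = 0" | "m = 1" | "m = 2" using up by linarith
      then show ?thesis
      proof cases
        case 1
        then show ?thesis using up by simp
      next
        case 2
        obtain y where y: "y \<in> N w" "y \<noteq> s" using ex_nbr_neq wV by blast
        then have "y \<in> L 2 b" using rest[of y] level_2I[of w a y] 2 up by simp
        then show ?thesis using uniq[OF _ level_4I[OF w y(1)], of 2] k by simp
      next
        case 3
        then show ?thesis using up n2 by simp
      qed
    next
      case up2
      then show ?thesis using n2 by simp
    qed
  qed
  show False
  proof (cases "k = 4")
    case False
    then have "N x \<subseteq> N s" using Nx by blast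
    then have "N x = N s" using nbr_subset_eq xV sV by blast
    moreover obtain j where j: "k - 3 = Suc j" using k by (cases "k - 3") auto
    ultimately have "b \<in> L (k - 3) x" using s(2) by simp
    then have "b \<in> L (2 + (k - 3)) b" using level_addI[OF x2] by blast
    then have "b \<in> L (k - 1) b" unfolding k13 .
    then show False using cyc[of "k - 1"] k by simp
  next
    case k4: True
    have v3: "v \<notin> L i b" if "i \<le> 3" for i
      using level_SucI[of v N i b b] vb cyc[of "Suc i"] that k by auto
    have "v \<notin> outliers u" using v3[of 2] v3[of 1] x2 Ou by auto
    then have "v \<in> L 3 a" using fork_v_cases[OF F] k4 by simp
    then obtain y where y: "y \<in> L 2 a" "v \<in> N y" using level_3D by blast
    have "y = s" using rest[OF y(1)] level_3I[OF _ y(2)] v3[of 3] by auto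
    moreover have "b \<noteq> v" using v3[of 0] by auto
    ultimately have Ns: "N s = {b, v}" using nbr_two[OF sV, of b v] s y k4 by simp
    \<comment> \<open>Since \<open>u\<close> leads to \<open>a\<close>, the two exceptions do not
      both occur, so \<open>x\<close> has an out-neighbour in \<open>N s = {b, v}\<close>. Either
      choice closes a cycle through \<open>b\<close>.\<close>
    have "\<not> (u \<in> N x \<and> a \<in> N x)"
    proof
      assume h: "u \<in> N x \<and> a \<in> N x"
      then have "a \<in> L 2 x" using level_2I[of u x a] f by simp
      then show False using level_unique[OF xV, of a 1 2] h k by simp
    qed
    moreover obtain c d where "N x = {c, d}" "c \<noteq> d" using nbr_elems xV by blast
    ultimately obtain w where "w \<in> N x" "w \<in> N s" using Nx by blast
    then have "w \<in> L 3 b" "w = b \<or> w = v" using level_3I x2 Ns by auto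
    then show False using v3[of 3] cyc[of 3] k by auto
  qed
qed

lemma fork_outlier: "fork u v z a b \<Longrightarrow> b \<in> outliers u"
  using fork_outlier_excess_2 fork_outlier_excess_3 excess by blast

section \<open>Location of the outliers and common out-neighbours of \<open>a\<close> and
  \<open>b\<close>\<close>

text \<open>Here \<open>a\<close> and \<open>b\<close> have the same levels at every positive depth.
  If \<open>v\<close> were \<open>k - 1\<close> steps below \<open>a\<close>, the arc from
  \<open>v\<close> to \<open>b\<close> would close a cycle of length \<open>k\<close>.\<close>

lemma fork_twin_outlier:
  assumes F: "fork u v z a b" and tw: "N b \<subseteq> N a"
  shows "v \<in> outliers u"
proof (rule ccontr)
  note f = forkD[OF F]
  assume "v \<notin> outliers u"
  then have v: "v \<in> L (k - 1) a" using fork_v_cases[OF F] by blast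
  obtain j where j: "k - 1 = Suc j" using large excess by (cases "k - 1") auto
  have "N b = N a" using nbr_subset_eq f tw by blast
  then have "v \<in> L (Suc j) b" using v j by simp
  then have "b \<in> L (Suc (Suc j)) b" using level_SucI f by fastforce
  then show False using no_cycle[OF f(4)] j by fastforce
qed

text \<open>By \<open>fork_outlier\<close> the outliers of \<open>u\<close> are \<open>b\<close> and
  one vertex \<open>x\<close>. Each out-neighbour of \<open>b\<close> is \<open>x\<close> or in
  \<open>N a\<close>; if none is \<open>x\<close>, then \<open>fork_twin_outlier\<close> gives
  \<open>x = v\<close>.\<close>

lemma fork_excess_2:
  assumes F: "fork u v z a b" and e: "e = 2"
  shows "N a \<inter> N b \<noteq> {}" "outliers u \<subseteq> insert v (insert b (N b))"
proof -
  note f = forkD[OF F]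
  have k: "3 \<le> k" using large e by auto
  note bO = fork_outlier[OF F]
  have uniq: "i = j" if "y \<in> L i b" "y \<in> L j b" "i \<le> k" "j \<le> k" for i j y
    using level_unique[OF f(4)] that by blast
  have cyc: "b \<notin> L i b" if "0 < i" "i \<le> k" for i using no_cycle[OF f(4)] that by blast
  have vb: "b \<in> N v" using f by simp
  obtain x where Ou: "outliers u = {b, x}"
    using card_2_other[OF _ bO] card_outliers[OF f(1)] e by blast
  have step: "y \<notin> N b" if "w \<in> N b" "y \<in> N w" for w y
    using uniq[of y 1 2] level_2I[OF that] k by auto
  have c1: "w = x \<or> w \<in> N a \<or> (k = 3 \<and> w \<in> L 2 a \<and> N w = {u, x})" if w: "w \<in> N b" for w
  proof -
    have wV: "w \<in> V" using nbr_in_V f w by blast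
    have "w \<in> L 1 b" "1 < k" using k w by auto
    with F show ?thesis
    proof (cases rule: fork_cases)
      case out
      then show ?thesis using cyc[of 1] w Ou k by auto
    next
      case down
      have "b \<notin> N w" using cyc[of 2] level_2I[OF w] k by auto
      then have "N w \<subseteq> {u, x}" using down Ou by auto
      moreover obtain c d where "N w = {c, d}" "c \<noteq> d" using nbr_elems wV by blast
      ultimately have "N w = {u, x}" by auto
      moreover from this have "k = 3" using down(4) by simp
      ultimately show ?thesis using down(2) by simp
    qed (use k e in auto)
  qed
  have sub: "N b \<subseteq> insert x (N a)"
  proof
    fix w assume w: "w \<in> N b"
    show "w \<in> insert x (N a)"
    proof (rule ccontr)
      assume "w \<notin> insert x (N a)"
      \<comment> \<open>In this exceptional case the parent \<open>y\<close> of \<open>w\<close>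
        below \<open>a\<close> also leads to \<open>v\<close>, and so reaches \<open>w\<close> a
        second time through \<open>v\<close> and \<open>b\<close>.\<close>
      then have k3: "k = 3" and wa: "w \<in> L 2 a" and Nw: "N w = {u, x}" using c1[OF w] by auto
      obtain w' where w': "N b = {w, w'}" "w \<noteq> w'" using nbr_other[OF f(4) w] by blast
      have "w' \<noteq> x" using step[OF w] Nw w' by auto
      moreover have "u \<notin> N w'"
        using branch_unique[OF f(4), of w w' u 1 1] w' Nw k by auto
      ultimately have w'a: "w' \<in> N a" using c1[of w'] w' by auto
      obtain y where y: "y \<in> N a" "w \<in> N y" using wa by (auto simp: level_2)
      have yV: "y \<in> V" using nbr_in_V f y by blast
      have "y \<noteq> w'" using step[of w' w] w' y by auto
      then have Na: "N a = {w', y}" using nbr_two[OF f(3)] w'a y by blast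
      have v2: "v \<notin> L 2 b" using level_3I[of v b b] cyc[of 3] vb k by auto
      have "v \<noteq> b" using vb cyc[of 1] k by auto
      moreover have "v \<noteq> x" using v2 level_2I[OF w, of x] Nw by auto
      ultimately have "v \<in> L 2 a" using fork_v_cases[OF F] k3 Ou by simp
      then obtain y' where y': "y' \<in> N a" "v \<in> N y'" by (auto simp: level_2)
      have "y' \<noteq> w'" using v2 level_2I[of w' b v] w' y' by auto
      then have "v \<in> N y" using Na y' by auto
      then have "w \<in> L 3 y" using level_3I[OF level_2I[OF _ vb]] w by blast
      then show False using level_unique[OF yV, of w 1 3] y k by simp
    qed
  qed
  obtain w where "w \<in> N b" "w \<noteq> x" using ex_nbr_neq f by blast
  then show "N a \<inter> N b \<noteq> {}" using sub by auto
  show "outliers u \<subseteq> insert v (insert b (N b))"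
  proof (cases "x \<in> N b")
    case True
    then show ?thesis using Ou by auto
  next
    case False
    then have "v \<in> outliers u" using fork_twin_outlier[OF F] sub by auto
    moreover have "v \<noteq> b" using vb cyc[of 1] k by auto
    ultimately show ?thesis using Ou by auto
  qed
qed

text \<open>An out-neighbour \<open>w\<close> of \<open>b\<close> that is neither an outlier of
  \<open>u\<close> nor in \<open>N a\<close> must lead exactly to the two outliers other than
  \<open>b\<close>. The alternatives arise from whether such a \<open>w\<close> exists and, if not,
  from whether both, one or none of the out-neighbours of \<open>b\<close> are outliers.\<close>

lemma fork_excess_3_children:
  assumes F: "fork u v z a b" and e: "e = 3"
  shows "outliers u = insert b (N b) \<or> N a \<inter> N b \<noteq> {} \<and>
    (outliers u \<subseteq> insert b (L 2 b) \<or> (\<exists>r\<in>outliers u. r \<noteq> b \<and> (r = v \<or> r \<in> N b)))"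
proof -
  note f = forkD[OF F]
  have k: "4 \<le> k" using large e by auto
  note bO = fork_outlier[OF F]
  have cyc: "b \<notin> L i b" if "0 < i" "i \<le> k" for i using no_cycle[OF f(4)] that by blast
  have card2: "card (outliers u - {b}) = 2" using card_outliers[OF f(1)] e bO by simp
  have c1: "w \<in> outliers u \<or> w \<in> N a \<or> N w = outliers u - {b}" if w: "w \<in> N b" for w
  proof -
    have wV: "w \<in> V" using nbr_in_V f w by blast
    have "w \<in> L 1 b" "1 < k" using k w by auto
    with F show ?thesis
    proof (cases rule: fork_cases)
      case down
      have "b \<notin> N w" using cyc[of 2] level_2I[OF w] k by auto
      then have "N w \<subseteq> outliers u - {b}" using down k by auto
      then have "N w = outliers u - {b}"
        using card2 outdeg[OF wV] finite_outliers by (intro card_subset_eq) auto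
      then show ?thesis by blast
    next
      case down2
      then have "b \<in> L 2 w" using bO by simp
      then have "b \<in> L (Suc 2) b" using level_consI[of w N b] w by blast
      then show ?thesis using cyc[of "Suc 2"] k by simp
    qed (use k in auto)
  qed
  show ?thesis
  proof (cases "\<exists>w\<in>N b. N w = outliers u - {b}")
    case True
    then obtain w where w: "w \<in> N b" "N w = outliers u - {b}" by blast
    obtain w' where w': "N b = {w, w'}" "w \<noteq> w'" using nbr_other[OF f(4) w(1)] by blast
    have "outliers u \<subseteq> insert b (L 2 b)" using level_2I[OF w(1)] w(2) by blast
    moreover have "w' \<in> N a"
    proof (rule ccontr)
      assume "w' \<notin> N a"
      then consider "w' \<in> outliers u" | "N w' = outliers u - {b}" using c1[of w'] w' by blast
      then show False
      proof cases
        case 1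
        moreover have "w' \<noteq> b" using cyc[of 1] w' k by auto
        ultimately have "w' \<in> L 2 b" using level_2I[OF w(1)] w(2) by blast
        then show False using level_unique[OF f(4), of w' 1 2] w' k by simp
      next
        case 2
        obtain y where "y \<in> N w" using ex_nbr_neq nbr_in_V f w(1) by blast
        then show False using branch_unique[OF f(4), of w w' y 1 1] w w' 2 k by simp
      qed
    qed
    ultimately show ?thesis using w' by blast
  next
    case False
    then have c2: "w \<in> outliers u \<or> w \<in> N a" if "w \<in> N b" for w using c1 that by blast
    show ?thesis
    proof (cases "N b \<subseteq> outliers u")
      case True
      then have "insert b (N b) \<subseteq> outliers u" using bO by simp
      moreover have "card (insert b (N b)) = 3"
        using cyc[of 1] outdeg[OF f(4)] finite_level[OF f(4), of 1] k by simp
      ultimately have "insert b (N b) = outliers u"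
        using card_outliers[OF f(1)] e finite_outliers by (intro card_subset_eq) auto
      then show ?thesis by simp
    next
      case nsub: False
      then have share: "N a \<inter> N b \<noteq> {}" using c2 by blast
      show ?thesis
      proof (cases "N b \<subseteq> N a")
        case True
        then have "v \<in> outliers u" using fork_twin_outlier[OF F] by blast
        moreover have "v \<noteq> b" using f cyc[of 1] k by auto
        ultimately show ?thesis using share by blast
      next
        case False
        then obtain r where "r \<in> N b" "r \<in> outliers u" using c2 by blast
        moreover from this have "r \<noteq> b" using cyc[of 1] k by auto
        ultimately show ?thesis using share by blast
      qed
    qed
  qed
qed

text \<open>Without a common out-neighbour, the first alternative of
  \<open>fork_excess_3_children\<close> holds for the fork and for its mirror image. Then the second
  levels of \<open>a\<close> and \<open>b\<close> agree, so \<open>v\<close> lies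
  \<open>k - 1\<close> steps below \<open>b\<close> as well, and its arc to \<open>b\<close> closes
  a cycle.\<close>

lemma fork_excess_3:
  assumes F: "fork u v z a b" and e: "e = 3"
  shows "N a \<inter> N b \<noteq> {}"
    "outliers u \<subseteq> insert b (L 2 b) \<or> (\<exists>r\<in>outliers u. r \<noteq> b \<and> (r = v \<or> r \<in> N b))"
proof -
  note f = forkD[OF F]
  have k: "4 \<le> k" using large e by auto
  have cyc: "b \<notin> L i b" if "0 < i" "i \<le> k" for i using no_cycle[OF f(4)] that by blast
  have uniq: "i = j" if "y \<in> L i b" "y \<in> L j b" "i \<le> k" "j \<le> k" for i j y
    using level_unique[OF f(4)] that by blast
  show share: "N a \<inter> N b \<noteq> {}"
  proof
    assume ns: "N a \<inter> N b = {}"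
    then have Ou: "outliers u = insert b (N b)" and Ov: "outliers v = insert a (N a)"
      using fork_excess_3_children[OF F e] fork_excess_3_children[OF fork_sym[OF F] e] by blast+
    have lev: "y \<notin> outliers u" if "y \<in> L i b" "2 \<le> i" "i \<le> k" for y i
      using uniq[of y i 1] that cyc[of i] Ou k by auto
    have "L 2 b \<subseteq> L 2 a"
    proof
      fix w assume w: "w \<in> L 2 b"
      have wV: "w \<in> V" using level_in_V f w by blast
      have "2 < k" using k by simp
      with F w show "w \<in> L 2 a"
      proof (cases rule: fork_cases)
        case out
        then show ?thesis using lev[OF w] k by simp
      next
        case down
        obtain y where "y \<in> N w" "y \<noteq> u" using ex_nbr_neq wV by blast
        then show ?thesis using lev[OF level_3I[OF w]] down k by fastforce
      next
        case down2
        then have "b \<in> L 2 w" using Ou by simp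
        then have "b \<in> L (2 + 2) b" using level_addI[OF w] by blast
        then show ?thesis using cyc[of "2 + 2"] k by simp
      next
        case up2
        then have "w \<in> N a" by simp
        then have "w \<in> outliers v" using Ov by simp
        then show ?thesis using outlier_not_below[of w v b 2] f w k by simp
      qed (use k in auto)
    qed
    then have L2: "L 2 b = L 2 a"
      using card_level[OF f(3), of 2] card_level[OF f(4), of 2] k finite_level[OF f(3)]
      by (intro card_subset_eq) auto
    have vlev: "v \<notin> L i b" if "i < k" for i
      using level_SucI[of v N i b b] f cyc[of "Suc i"] that by auto
    have "v \<notin> outliers u" using vlev[of 0] vlev[of 1] Ou k by auto
    then have "v \<in> L (k - 1) a" using fork_v_cases[OF F] by blast
    moreover have "L (2 + (k - 3)) b = L (2 + (k - 3)) a" using L2 by (simp only: level_add)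
    moreover have "2 + (k - 3) = k - 1" using k by simp
    ultimately have "v \<in> L (k - 1) b" by (simp only:)
    then show False using vlev[of "k - 1"] k by simp
  qed
  show "outliers u \<subseteq> insert b (L 2 b) \<or> (\<exists>r\<in>outliers u. r \<noteq> b \<and> (r = v \<or> r \<in> N b))"
    using fork_excess_3_children[OF F e] ex_nbr_neq[OF f(4), of b] by blast
qed

section \<open>Exclusion of forks\<close>

text \<open>Take the second in-neighbour \<open>u'\<close> of \<open>a\<close>; its other
  out-neighbour is not \<open>z\<close>, whose in-neighbours are \<open>u\<close> and
  \<open>v\<close>. The new fork keeps \<open>u\<close>, so both forks constrain the same set of
  outliers.\<close>

lemma fork_rotate:
  assumes F: "fork u v z a b"
  obtains u' z' where "fork u u' a z z'"
proof -
  note f = forkD[OF F]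
  have "u \<in> {x \<in> V. a \<in> N x}" using f by simp
  then obtain u' where u': "{x \<in> V. a \<in> N x} = {u, u'}" "u \<noteq> u'"
    using card_2_other[OF indeg[OF f(3)]] by blast
  have u'V: "u' \<in> V" "a \<in> N u'" using u' by blast+
  then obtain z' where z': "N u' = {a, z'}" "a \<noteq> z'" using nbr_other by blast
  have "z' \<noteq> z"
  proof
    assume "z' = z"
    then have "{u, v, u'} \<subseteq> {x \<in> V. z \<in> N x}" using f z' u'V by auto
    then have "card {u, v, u'} \<le> 2"
      using card_mono[of "{x \<in> V. z \<in> N x}" "{u, v, u'}"] indeg[OF f(5)] fin by simp
    moreover have "u' \<noteq> v" using f z' by (auto simp: doubleton_eq_iff)
    ultimately show False using f u' by (simp add: card_insert_if split: if_splits)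
  qed
  then have "fork u u' a z z'" using f z' u'V by (auto simp: fork_def)
  then show ?thesis by (rule that)
qed

text \<open>A common out-neighbour of \<open>z\<close> and \<open>z'\<close> is reached from
  \<open>v\<close> through \<open>z\<close>, so \<open>v\<close> must not reach it through
  \<open>b\<close> and \<open>z'\<close> too.\<close>

lemma fork_share_apart:
  assumes F: "fork u v z a b" and sh: "N z \<inter> N z' \<noteq> {}"
  shows "z' \<noteq> v" "i + 1 < k \<Longrightarrow> z' \<notin> L i b"
proof -
  note f = forkD[OF F]
  obtain s where s: "s \<in> N z" "s \<in> N z'" using sh by blast
  have k: "3 \<le> k" using large excess by auto
  have apart: "s \<notin> L j b" if "j < k" for j
    using branch_unique[OF f(2), of b z s j 1] s f that k by auto
  show "z' \<noteq> v"
  proof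
    assume "z' = v"
    then have "s = z" using s apart[of 0] f k by auto
    then show False using no_cycle[OF f(5), of 1] s k by simp
  qed
  show "z' \<notin> L i b" if "i + 1 < k"
    using apart[of "Suc i"] level_SucI[of z' N i b s] s that by auto
qed

text \<open>The fork and its rotation make \<open>b\<close> and \<open>z'\<close> outliers of
  \<open>u\<close> that are far apart. For \<open>e = 2\<close> this contradicts
  \<open>fork_excess_2\<close>. For \<open>e = 3\<close> each fork demands a further outlier; only
  one vertex \<open>r\<close> is left for both, and each of its possible positions is
  excluded.\<close>

theorem no_fork: "\<not> fork u v z a b"
proof
  assume F: "fork u v z a b"
  note f = forkD[OF F]
  obtain u' z' where F': "fork u u' a z z'" using fork_rotate F by blast
  note f' = forkD[OF F']
  have z'O: "z' \<in> outliers u" using fork_outlier[OF F'] .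
  have share: "N a \<inter> N b \<noteq> {}" if "fork u v z a b" for u v z a b
    using fork_excess_2(1)[OF that] fork_excess_3(1)[OF that] excess by auto
  note ap = fork_share_apart[OF F share[OF F']] and ap' = fork_share_apart[OF F' share[OF F]]
  from excess show False
  proof
    assume e: "e = 2"
    have "z' = b \<or> z' \<in> N b" using fork_excess_2(2)[OF F e] z'O ap(1) by auto
    then show False using ap(2)[of 0] ap(2)[of 1] large e by auto
  next
    assume e: "e = 3"
    have k: "4 \<le> k" using large e by simp
    have far: "z' \<noteq> b" "z' \<notin> N b" "z' \<notin> L 2 b" "b \<notin> N z'" "b \<notin> L 2 z'"
      using ap(2)[of 0] ap(2)[of 1] ap(2)[of 2] ap'(2)[of 1] ap'(2)[of 2] k by auto
    have "b \<in> outliers u" using fork_outlier[OF F] .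
    obtain r where r: "r \<in> outliers u" "r \<noteq> b" "r = v \<or> r \<in> N b"
      using fork_excess_3(2)[OF F e] far z'O by blast
    obtain r' where r': "r' \<in> outliers u" "r' \<noteq> z'" "r' = u' \<or> r' \<in> N z'"
      using fork_excess_3(2)[OF F' e] far \<open>b \<in> outliers u\<close> by blast
    have "r \<noteq> z'" "r' \<noteq> b" using r r' ap(1) ap'(1) far by auto
    have "card {b, r, z'} = 3" using r far \<open>r \<noteq> z'\<close> by auto
    then have "outliers u = {b, r, z'}"
      using card_outliers[OF f(1)] e finite_outliers z'O r \<open>b \<in> outliers u\<close>
        card_subset_eq[of "outliers u" "{b, r, z'}"] by auto
    then have eq: "r' = r" using r' \<open>r' \<noteq> b\<close> by blast
    consider "r = v" "r = u'" | "r = v" "v \<in> N z'" | "r = u'" "u' \<in> N b" | "r \<in> N b" "r \<in> N z'"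
      using r r' eq by blast
    then show False
    proof cases
      case 1
      then show False using f f' by (auto simp: doubleton_eq_iff)
    next
      case 2
      then show False using level_2I[of v z' b] f far by simp
    next
      case 3
      then show False using level_2I[of u' b z'] f' far by simp
    next
      case 4
      obtain c where c: "c \<in> N a" "c \<in> N b" using share[OF F] by blast
      obtain c' where c': "c' \<in> N z" "c' \<in> N z'" using share[OF F'] by blast
      have "c \<noteq> r" "c' \<noteq> r"
        using outlier_not_below[OF r(1), of a 1] outlier_not_below[OF r(1), of z 1] f c c' k by auto
      have "c \<noteq> c'" using branch_unique[OF f(1), of a z c 1 1] f c c' k by auto
      have "N b = {c, r}" "N z' = {c', r}"
        using nbr_two[OF f(4) c(2) 4(1) \<open>c \<noteq> r\<close>] nbr_two[OF f'(4) c'(2) 4(2) \<open>c' \<noteq> r\<close>] .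
      \<comment> \<open>In this new fork \<open>c\<close> and \<open>c'\<close> again have a common
        out-neighbour, which \<open>u\<close> would reach both through \<open>a\<close> and through
        \<open>z\<close>.\<close>
      then have "fork b z' r c c'" using f f' \<open>c \<noteq> r\<close> \<open>c' \<noteq> r\<close> \<open>c \<noteq> c'\<close> by (simp add: fork_def)
      then obtain s where "s \<in> N c" "s \<in> N c'" using share by blast
      then have "s \<in> L 2 a" "s \<in> L 2 z" using level_2I c c' by blast+
      then show False using branch_unique[OF f(1), of a z s 2 2] f k by auto
    qed
  qed
qed

section \<open>Line digraph structure and reduction of the excess\<close>

lemma nbr_eq_of_common:
  assumes "x \<in> V" "y \<in> V" "w \<in> N x" "w \<in> N y"
  shows "N x = N y"
proof (rule ccontr)
  assume ne: "N x \<noteq> N y"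
  obtain a where a: "N x = {w, a}" "w \<noteq> a" using nbr_other assms by blast
  obtain b where b: "N y = {w, b}" "w \<noteq> b" using nbr_other assms by blast
  have "fork x y w a b" using assms a b ne by (auto simp: fork_def)
  then show False using no_fork by blast
qed

lemma ex_in_nbr: "y \<in> V \<Longrightarrow> \<exists>x\<in>V. y \<in> N x"
  using indeg[of y] by (auto simp: card_2_iff)

text \<open>Out-neighbourhoods are equal or disjoint, so they partition \<open>V\<close> into
  pairs.\<close>

lemma card_nbr_classes: "card V = 2 * card (N ` V)"
proof -
  have "2 * card (N ` V) = card (\<Union> (N ` V))"
  proof (rule card_partition)
    show "C \<inter> D = {}" if "C \<in> N ` V" "D \<in> N ` V" "C \<noteq> D" for C D
      using that nbr_eq_of_common by blast
  qed (use fin outdeg nbr_sub in \<open>auto intro: finite_subset[OF _ fin]\<close>)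
  moreover have "\<Union> (N ` V) = V" using ex_in_nbr nbr_sub by blast
  ultimately show ?thesis by simp
qed

end

text \<open>For \<open>e = 2\<close> the order is odd, contrary to the partition into pairs.\<close>

lemma no_excess_2: "\<not> excess_digraph V N k 2"
proof
  assume "excess_digraph V N k 2"
  then interpret excess_digraph V N k 2 .
  have "2 * card (N ` V) + 1 = 2 * 2 ^ k + 2" using order card_nbr_classes by simp
  then show False by presburger
qed

text \<open>A vertex \<open>x\<close> is the arc from the class containing \<open>x\<close> to the class \<open>N x\<close>, whence the
  adjacency \<open>C \<mapsto> N ` C\<close>.\<close>

lemma (in excess_digraph) line_digraph_root:
  assumes e: "e = 3"
  shows "excess_digraph (N ` V) (\<lambda>C. N ` C) (k - 1) 2"
proof -
  have k: "4 \<le> k" using large e by simp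
  \<comment> \<open>Levels from the class \<open>N x\<close> lag one behind those from
    \<open>x\<close>, which accounts for \<open>k - 1\<close>.\<close>
  have lev: "\<Union> (level (\<lambda>C. N ` C) i (N x)) = L (Suc i) x" for i x
  proof (induction i arbitrary: x)
    case (Suc i)
    have "\<Union> (level (\<lambda>C. N ` C) (Suc i) (N x)) = (\<Union>y\<in>N x. \<Union> (level (\<lambda>C. N ` C) i (N y)))"
      by auto
    then show ?case unfolding Suc by simp
  qed simp
  have lev_sub: "level (\<lambda>C. N ` C) i (N x) \<subseteq> N ` V" if "x \<in> V" for i x
    using that
  proof (induction i arbitrary: x)
    case (Suc i)
    then show ?case using nbr_in_V by fastforce
  qed simp
  \<comment> \<open>Classes are non-empty, so a class reached in two ways contains a vertex reached
    in two ways. Thus \<open>pick\<close> and \<open>lev'\<close> transfer both geodecity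
    conditions.\<close>
  have pick: "\<exists>y. y \<in> D \<and> y \<in> L (Suc i) x"
    if xD: "x \<in> V" "D \<in> level (\<lambda>C. N ` C) i (N x)" for x D i
  proof -
    obtain w where "w \<in> V" "D = N w" using lev_sub xD by blast
    then obtain y where "y \<in> D" using ex_nbr_neq by blast
    then show ?thesis using xD lev[of i x] by blast
  qed
  have lev': "y \<in> L (Suc i) x" if "D \<in> level (\<lambda>C. N ` C) i (N x)" "y \<in> D" for x D i y
    using that lev[of i x] by blast
  have inj: "inj_on N (N x)" if xV: "x \<in> V" for x
  proof (rule inj_onI)
    fix c d assume cd: "c \<in> N x" "d \<in> N x" "N c = N d"
    obtain y where "y \<in> N c" using ex_nbr_neq nbr_in_V[OF xV cd(1)] by blast
    then show "c = d" using branch_unique[OF xV cd(1,2), of y 1 1] cd k by simp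
  qed
  show ?thesis
  proof
    show "finite (N ` V)" using fin by simp
    show "N ` C \<subseteq> N ` V" if "C \<in> N ` V" for C using that nbr_sub by blast
    show "card (N ` C) = 2" if "C \<in> N ` V" for C
      using that inj outdeg by (auto simp: card_image)
    show "card {C \<in> N ` V. D \<in> N ` C} = 2" if D: "D \<in> N ` V" for D
    proof -
      obtain w where w: "w \<in> V" "D = N w" using D by blast
      obtain y where y: "y \<in> D" using ex_nbr_neq w by blast
      have yV: "y \<in> V" using nbr_in_V w y by blast
      \<comment> \<open>The vertices with out-neighbourhood \<open>D\<close> are the two
        in-neighbours of \<open>y\<close>, and \<open>inj\<close> puts them into different
        classes.\<close>
      obtain p q where pq: "{x \<in> V. y \<in> N x} = {p, q}" "p \<noteq> q"
        using indeg[OF yV] by (auto simp: card_2_iff)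
      have pqV: "p \<in> V" "q \<in> V" "y \<in> N p" "y \<in> N q" using pq by blast+
      obtain p' where p': "p' \<in> V" "p \<in> N p'" using ex_in_nbr pqV by blast
      obtain q' where q': "q' \<in> V" "q \<in> N q'" using ex_in_nbr pqV by blast
      have D_eq: "N p = D" "N q = D" using nbr_eq_of_common pqV w y by blast+
      have "N p' \<noteq> N q'"
        using inj_onD[OF inj[OF p'(1)], of p q] D_eq p' q' pq by auto
      moreover have "{C \<in> N ` V. D \<in> N ` C} = {N p', N q'}"
      proof
        show "{N p', N q'} \<subseteq> {C \<in> N ` V. D \<in> N ` C}" using p' q' D_eq by blast
        show "{C \<in> N ` V. D \<in> N ` C} \<subseteq> {N p', N q'}"
        proof
          fix C assume "C \<in> {C \<in> N ` V. D \<in> N ` C}"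
          then obtain c x where cx: "c \<in> V" "C = N c" "x \<in> N c" "D = N x" by blast
          then have "x \<in> {x \<in> V. y \<in> N x}" using nbr_in_V y by blast
          then have "x = p \<or> x = q" using pq by blast
          then show "C \<in> {N p', N q'}" using nbr_eq_of_common cx p' q' by blast
        qed
      qed
      ultimately show ?thesis by simp
    qed
    show "i = j" if h: "C \<in> N ` V" "D \<in> level (\<lambda>C. N ` C) i C" "D \<in> level (\<lambda>C. N ` C) j C"
      "i \<le> k - 1" "j \<le> k - 1" for C D i j
    proof -
      obtain x where x: "x \<in> V" "C = N x" using h by blast
      obtain y where y: "y \<in> D" "y \<in> L (Suc i) x" using pick x h by blast
      have y': "y \<in> L (Suc j) x" using lev' x y h by blast
      have "Suc i \<le> k" "Suc j \<le> k" using h k by auto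
      then show ?thesis using level_unique[OF x(1) y(2) y'] by simp
    qed
    show "level (\<lambda>C. N ` C) i C1 \<inter> level (\<lambda>C. N ` C) j C2 = {}"
      if h: "C \<in> N ` V" "C1 \<in> N ` C" "C2 \<in> N ` C" "C1 \<noteq> C2" "i < k - 1" "j < k - 1" for C C1 C2 i j
    proof (rule ccontr)
      assume "level (\<lambda>C. N ` C) i C1 \<inter> level (\<lambda>C. N ` C) j C2 \<noteq> {}"
      then obtain D where D: "D \<in> level (\<lambda>C. N ` C) i C1" "D \<in> level (\<lambda>C. N ` C) j C2" by blast
      obtain w x1 x2 where w: "w \<in> V" "x1 \<in> N w" "x2 \<in> N w" "C1 = N x1" "C2 = N x2"
        using h by blast
      obtain y where y: "y \<in> D" "y \<in> L (Suc i) x1" using pick[of x1 D i] nbr_in_V w D by blast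
      have y': "y \<in> L (Suc j) x2" using lev' w y D by blast
      have "Suc i < k" "Suc j < k" using h by auto
      then show False using branch_unique[OF w(1-3) y(2) y'] h w by simp
    qed
    show "card (N ` V) + 1 = 2 ^ Suc (k - 1) + 2"
    proof -
      have "2 * card (N ` V) + 1 = 2 * 2 ^ k + 3" using order card_nbr_classes e by simp
      then show ?thesis using k by (simp add: Suc_diff_le)
    qed
    show "2 < k - 1" using k by simp
  qed simp
qed

lemma no_excess_3: "\<not> excess_digraph V N k 3"
  using excess_digraph.line_digraph_root no_excess_2 by metis

section \<open>From walks to levels\<close>

lemma is_walk_Cons:
  assumes "x \<in> V" "E x (hd p)" "is_walk V E p"
  shows "is_walk V E (x # p)"
  using assms by (auto simp: is_walk_def nth_Cons hd_conv_nth split: nat.split)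

lemma level_imp_walk:
  assumes "x \<in> V" "y \<in> level (out_nbrs V E) i x"
  shows "\<exists>p. is_walk V E p \<and> hd p = x \<and> last p = y \<and> length p = Suc i"
  using assms
proof (induction i arbitrary: x)
  case 0
  then show ?case by (intro exI[of _ "[x]"]) (auto simp: is_walk_def)
next
  case (Suc i)
  then obtain c where c: "c \<in> V" "E x c" "y \<in> level (out_nbrs V E) i c"
    using out_nbrs_def[of V E x] by auto
  then obtain p where p: "is_walk V E p" "hd p = c" "last p = y" "length p = Suc i"
    using Suc.IH by blast
  then show ?case using is_walk_Cons[of x V E p] Suc.prems c
    by (intro exI[of _ "x # p"]) (auto simp: is_walk_def)
qed

text \<open>Equal walks have equal lengths, which gives \<open>level_unique\<close>. For
  \<open>branch_disjoint\<close> both walks are extended by \<open>x\<close> at the front; this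
  costs one step, whence the strict bounds on \<open>i\<close> and \<open>j\<close>.\<close>

lemma geodetic_excess_digraph:
  assumes fin: "finite V" and reg: "diregular V E 2" and geo: "k_geodetic V E k"
    and ord: "card V = moore_bound 2 k + 3" and k: "4 \<le> k"
  shows "excess_digraph V (out_nbrs V E) k 3"
proof
  let ?N = "out_nbrs V E"
  have sub: "?N x \<subseteq> V" for x by (auto simp: out_nbrs_def)
  have geoD: "p = q" if "is_walk V E p" "is_walk V E q" "hd p = hd q" "last p = last q"
    "length p \<le> Suc k" "length q \<le> Suc k" for p q
  proof -
    have "hd p \<in> V" "last p \<in> V" using that(1) by (auto simp: is_walk_def)
    then show ?thesis using geo that unfolding k_geodetic_def by metis
  qed
  show "finite V" by (fact fin)
  show "?N x \<subseteq> V" for x by (fact sub)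
  show "card (?N x) = 2" if "x \<in> V" for x using reg that by (simp add: diregular_def)
  show "card {x \<in> V. y \<in> ?N x} = 2" if "y \<in> V" for y
    using reg that by (simp add: diregular_def in_nbrs_def out_nbrs_def)
  show "i = j" if h: "x \<in> V" "y \<in> level ?N i x" "y \<in> level ?N j x" "i \<le> k" "j \<le> k" for x y i j
  proof -
    obtain p q where pq: "is_walk V E p" "hd p = x" "last p = y" "length p = Suc i"
      "is_walk V E q" "hd q = x" "last q = y" "length q = Suc j"
      using level_imp_walk[OF h(1,2)] level_imp_walk[OF h(1,3)] by blast
    have "p = q" using geoD[of p q] pq h by simp
    then show ?thesis using pq by simp
  qed
  show "level ?N i c \<inter> level ?N j d = {}"
    if "x \<in> V" "c \<in> ?N x" "d \<in> ?N x" "c \<noteq> d" "i < k" "j < k" for x c d i j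
  proof (rule ccontr)
    assume "level ?N i c \<inter> level ?N j d \<noteq> {}"
    then obtain y where y: "y \<in> level ?N i c" "y \<in> level ?N j d" by blast
    have V: "c \<in> V" "d \<in> V" "E x c" "E x d" using that by (auto simp: out_nbrs_def)
    obtain p where p: "is_walk V E p" "hd p = c" "last p = y" "length p = Suc i"
      using level_imp_walk[OF V(1) y(1)] by blast
    obtain q where q: "is_walk V E q" "hd q = d" "last q = y" "length q = Suc j"
      using level_imp_walk[OF V(2) y(2)] by blast
    have "p \<noteq> []" "q \<noteq> []" using p q by auto
    then have "x # p = x # q"
      using geoD[of "x # p" "x # q"] is_walk_Cons[of x V E p] is_walk_Cons[of x V E q] p q V that
      by simp
    then show False using p q that by simp
  qed
  have "(\<Sum>i\<le>k. 2 ^ i) + 1 = (2::nat) ^ Suc k" by (induction k) auto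
  then show "card V + 1 = 2 ^ Suc k + 3" using ord by (simp add: moore_bound_def)
qed (use k in auto)

theorem theorem4:
  fixes V :: "'a set" and E :: "'a \<Rightarrow> 'a \<Rightarrow> bool" and k :: nat
  assumes "k \<ge> 4"
    and "finite V"
    and "diregular V E 2"
    and "card V = moore_bound 2 k + 3"
  shows "\<not> k_geodetic V E k"
  using geodetic_excess_digraph no_excess_3 assms by blast

end
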